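(* Let $G$ be a finite directed acyclic graph with a unique source $s$ and a unique sink $t$ and with no idle edges. Then $G$ satisfies degree equality if and only if $G$ admits a route decomposition.
   Context: Directed graphs may have parallel edges. The vertices of $G$ are linearly ordered $s<1<2<\cdots<n<t$ so that every directed edge $(i,j)$ has $i<j$; the vertices $1,\dots,n$ are called inner vertices. An edge is idle if it is the only incoming edge or the only outgoing edge of some inner vertex. A route is a directed path in $G$ from $s$ to $t$ (regarded as a sequence of edges). $G$ satisfies degree equality if $\mathrm{indeg}_G(v)=\mathrm{outdeg}_G(v)$ for every inner vertex $v$. A route decomposition of $G$ is a set $\mathcal{R}$ of routes in $G$ such that the edge set of $G$ is the disjoint union of the edge sets of the routes in $\mathcal{R}$. *)

theory Defs
  imports "Graph_Theory.Digraph" "Graph_Theory.Arc_Walk"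
begin

locale st_dag = fin_digraph G for G :: "('a, 'b) pre_digraph" (structure) +
  fixes s t :: 'a
  assumes acyclic: "\<nexists>p. cycle p"
    and unique_source: "{v \<in> verts G. in_degree G v = 0} = {s}"
    and unique_sink: "{v \<in> verts G. out_degree G v = 0} = {t}"
    and source_neq_sink: "s \<noteq> t"
begin

definition inner_verts :: "'a set" where
  "inner_verts = verts G - {s, t}"

definition idle :: "'b \<Rightarrow> bool" where
  "idle e \<longleftrightarrow> (\<exists>v \<in> inner_verts. in_arcs G v = {e} \<or> out_arcs G v = {e})"

definition degree_equality :: bool where
  "degree_equality \<longleftrightarrow> (\<forall>v \<in> inner_verts. in_degree G v = out_degree G v)"

text \<open>A route is the list of its arcs, so parallel arcs give different routes. It is
  never empty, because \<open>s \<noteq> t\<close>.\<close>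

definition route :: "'b list \<Rightarrow> bool" where
  "route p \<longleftrightarrow> apath s p t"

definition route_decomposition :: "'b list set \<Rightarrow> bool" where
  "route_decomposition R \<longleftrightarrow>
     (\<forall>p \<in> R. route p) \<and>
     arcs G = (\<Union>p \<in> R. set p) \<and>
     pairwise (\<lambda>p q. disjnt (set p) (set q)) R"

end

text \<open>The vertices of a finite acyclic digraph with unique source \<open>s\<close> and unique sink \<open>t\<close> are
  often labelled \<open>s < 1 < \<dots> < n < t\<close> with all arcs increasing. Such a labelling always exists
  and is not part of the locale; conversely, an increasing labelling implies acyclicity, so
  labelled graphs are covered:\<close>

lemma (in wf_digraph) increasing_labelling_imp_acyclic:
  fixes f :: "'a \<Rightarrow> 'c :: linorder"
  assumes "\<And>e. e \<in> arcs G \<Longrightarrow> f (tail G e) < f (head G e)"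
  shows "\<nexists>p. cycle p"
proof -
  have *: "f u < f v" if "awalk u p v" "p \<noteq> []" for u p v
    using that
  proof (induction p arbitrary: u)
    case (Cons e p)
    then have e: "e \<in> arcs G" "tail G e = u" "awalk (head G e) p v"
      by (auto simp: awalk_Cons_iff)
    show ?case
    proof (cases "p = []")
      case True
      with e assms[of e] show ?thesis by (auto simp: awalk_Nil_iff)
    next
      case False
      with e assms[of e] Cons.IH[of "head G e"] show ?thesis by auto
    qed
  qed simp
  then show ?thesis by (fastforce simp: cycle_def)
qed

end

theory Submission
  imports Defs
begin

text \<open>
  A walk from \<open>s\<close> to \<open>t\<close> enters every inner vertex as often as it leaves it, which gives degree
  equality after summation over a route decomposition. Conversely, a nonempty set of arcs that is
  balanced at the inner vertices contains a route, since a longest nonempty path in it can only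
  start at \<open>s\<close> and end at \<open>t\<close>; removing this route leaves a smaller balanced set.
\<close>

text \<open>Both sides count the visits of the walk to \<open>w\<close>: each visit is entered by an
  arc unless it is the start \<open>u\<close>, and left by an arc unless it is the end
  \<open>v\<close>.\<close>

lemma (in pre_digraph) cas_length_filter_head_tail:
  assumes "cas u p v"
  shows "length (filter (\<lambda>e. head G e = w) p) + (if w = u then 1 else 0) =
    length (filter (\<lambda>e. tail G e = w) p) + (if w = v then 1 else 0)"
  using assms by (induction u p v rule: cas.induct) auto

text \<open>The arcs of a path are distinct, so counts in the list become cardinalities of sets, and
  both end corrections vanish.\<close>

lemma (in wf_digraph) apath_card_head_tail:
  assumes "apath u p v" "w \<noteq> u" "w \<noteq> v"
  shows "card {e \<in> set p. head G e = w} = card {e \<in> set p. tail G e = w}"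
proof -
  have "distinct p" "cas u p v"
    using assms(1) by (auto simp: apath_def awalk_def intro: distinct_verts_imp_distinct)
  then show ?thesis
    using cas_length_filter_head_tail[of u p v w] assms(2,3)
    by (simp add: distinct_length_filter Int_def conj_commute)
qed

text \<open>A repeated vertex would split off a closed subwalk, and this would yield a
  cycle.\<close>

lemma (in wf_digraph) acyclic_awalk_imp_apath:
  assumes "\<nexists>p. cycle p" "awalk u p v"
  shows "apath u p v"
proof (rule ccontr)
  assume "\<not> apath u p v"
  then have "\<not> distinct (awalk_verts u p)"
    using assms(2) by (simp add: apath_def)
  from awalk_not_distinct_decomp[OF assms(2) this] have "\<exists>r. closed_w r"
    by (auto simp: closed_w_def)
  then show False
    using closed_w_imp_cycle assms(1) by blast
qed

context st_dag
begin

lemma no_in_arcs_source: "e \<in> arcs G \<Longrightarrow> head G e \<noteq> s"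
proof
  assume "e \<in> arcs G" "head G e = s"
  then have "e \<in> in_arcs G s" by simp
  moreover have "in_degree G s = 0" using unique_source by blast
  ultimately show False by (metis in_degree_def card_0_eq empty_iff finite_in_arcs)
qed

lemma no_out_arcs_sink: "e \<in> arcs G \<Longrightarrow> tail G e \<noteq> t"
proof
  assume "e \<in> arcs G" "tail G e = t"
  then have "e \<in> out_arcs G t" by simp
  moreover have "out_degree G t = 0" using unique_sink by blast
  ultimately show False by (metis out_degree_def card_0_eq empty_iff finite_out_arcs)
qed

text \<open>A property of arc sets inside the fixed \<open>G\<close> rather than of subgraphs, since
  what remains after deleting a route may have further sources and sinks and so leave the
  locale.\<close>

definition balanced :: "'b set \<Rightarrow> bool" where
  "balanced A \<longleftrightarrow>
     (\<forall>v \<in> inner_verts. card {e \<in> A. head G e = v} = card {e \<in> A. tail G e = v})"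

lemma balanced_arcs_iff: "balanced (arcs G) \<longleftrightarrow> degree_equality"
  by (simp add: balanced_def degree_equality_def in_degree_def out_degree_def
      in_arcs_def out_arcs_def)

lemma balanced_route: "route p \<Longrightarrow> balanced (set p)"
  by (auto simp: balanced_def route_def inner_verts_def intro: apath_card_head_tail)

lemma route_subset_arcs: "route p \<Longrightarrow> set p \<subseteq> arcs G"
  by (auto simp: route_def apath_def awalk_def)

lemma route_not_Nil: "route p \<Longrightarrow> p \<noteq> []"
  using source_neq_sink by (auto simp: route_def apath_Nil_iff)

lemma balanced_UN:
  assumes "finite R" "\<And>p. p \<in> R \<Longrightarrow> finite (f p)" "\<And>p. p \<in> R \<Longrightarrow> balanced (f p)"
    and "pairwise (\<lambda>p q. disjnt (f p) (f q)) R"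
  shows "balanced (\<Union>p\<in>R. f p)"
  unfolding balanced_def
proof
  fix v assume v: "v \<in> inner_verts"
  \<comment> \<open>The map \<open>g\<close> stands for both \<open>head G\<close> and
    \<open>tail G\<close>; disjointness makes the counts add up.\<close>
  have card_UN: "card {e \<in> \<Union>p\<in>R. f p. g e = v} = (\<Sum>p\<in>R. card {e \<in> f p. g e = v})"
    for g :: "'b \<Rightarrow> 'a"
  proof -
    have "{e \<in> \<Union>p\<in>R. f p. g e = v} = (\<Union>p\<in>R. {e \<in> f p. g e = v})" by auto
    also have "card \<dots> = (\<Sum>p\<in>R. card {e \<in> f p. g e = v})"
      using assms by (intro card_UN_disjoint) (auto simp: pairwise_def disjnt_iff)
    finally show ?thesis .
  qed
  show "card {e \<in> \<Union>p\<in>R. f p. head G e = v} = card {e \<in> \<Union>p\<in>R. f p. tail G e = v}"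
    unfolding card_UN using assms(3) v by (intro sum.cong) (auto simp: balanced_def)
qed

lemma balanced_Diff:
  assumes "finite A" "B \<subseteq> A" "balanced A" "balanced B"
  shows "balanced (A - B)"
proof -
  have "card {e \<in> A - B. g e = v} = card {e \<in> A. g e = v} - card {e \<in> B. g e = v}"
    for g :: "'b \<Rightarrow> 'a" and v
  proof -
    have "{e \<in> A - B. g e = v} = {e \<in> A. g e = v} - {e \<in> B. g e = v}" by auto
    then show ?thesis
      using assms(1,2) by (simp add: card_Diff_subset finite_subset subset_iff)
  qed
  then show ?thesis using assms(3,4) by (simp add: balanced_def)
qed

text \<open>This is what prolongs a walk in \<open>A\<close> at an inner end: an arc on one side of
  the vertex forces an arc on the other.\<close>

lemma balanced_ex_head_iff_ex_tail:
  assumes "finite A" "balanced A" "v \<in> inner_verts"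
  shows "(\<exists>e \<in> A. head G e = v) \<longleftrightarrow> (\<exists>e \<in> A. tail G e = v)"
proof -
  have "card {e \<in> A. head G e = v} = 0 \<longleftrightarrow> card {e \<in> A. tail G e = v} = 0"
    using assms(2,3) by (simp add: balanced_def)
  then show ?thesis using assms(1) by auto
qed

lemma balanced_imp_ex_route:
  assumes A: "A \<subseteq> arcs G" "A \<noteq> {}" and bal: "balanced A"
  shows "\<exists>p. route p \<and> set p \<subseteq> A"
proof -
  have fin: "finite A" using A(1) finite_arcs by (rule finite_subset)
  \<comment> \<open>Walks instead of paths, so that prolonging one needs no check for repeated
    vertices; acyclicity turns them into paths and thereby bounds their length.\<close>
  let ?P = "\<lambda>p. p \<noteq> [] \<and> set p \<subseteq> A \<and> (\<exists>u v. awalk u p v)"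
  obtain e where "e \<in> A" using A(2) by blast
  then have "?P [e]" using A(1) by (auto simp: awalk_Cons_iff awalk_Nil_iff)
  moreover have "\<forall>p. ?P p \<longrightarrow> length p < Suc (card (verts G))"
    using acyclic_awalk_imp_apath[OF acyclic] length_apath less_Suc_eq_le by blast
  ultimately obtain p where p: "?P p" and max: "\<And>q. ?P q \<Longrightarrow> length q \<le> length p"
    using ex_has_greatest_nat[of ?P "[e]" length "Suc (card (verts G))"] by blast
  then obtain u v where w: "awalk u p v" by blast
  \<comment> \<open>The ends are tied to the first and last arc, so \<open>A\<close> has an arc
    leaving \<open>u\<close> and one entering \<open>v\<close>.\<close>
  have "awhd u p = u" "awlast u p = v" using w unfolding awalk_conv by blast+
  moreover have "hd p \<in> A" "last p \<in> A" using p by (simp_all add: subset_iff)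
  ultimately have ends: "u = tail G (hd p)" "v = head G (last p)" "hd p \<in> A" "last p \<in> A"
    using p by (simp_all add: awalk_verts_conv hd_map)
  have "u = s"
  proof (rule ccontr)
    assume "u \<noteq> s"
    \<comment> \<open>As the tail of an arc, \<open>u\<close> cannot be the sink.\<close>
    then have "u \<in> inner_verts"
      using ends w A(1) no_out_arcs_sink by (auto simp: inner_verts_def)
    then obtain e where "e \<in> A" "head G e = u"
      using balanced_ex_head_iff_ex_tail[OF fin bal] ends by blast
    then have "?P (e # p)" using p w A(1) by (auto simp: awalk_Cons_iff)
    from max[OF this] show False by simp
  qed
  moreover have "v = t"
  proof (rule ccontr)
    assume "v \<noteq> t"
    \<comment> \<open>Dually, \<open>v\<close> is the head of an arc and hence not the
      source.\<close>
    then have "v \<in> inner_verts"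
      using ends w A(1) no_in_arcs_source by (auto simp: inner_verts_def)
    then obtain e where e: "e \<in> A" "tail G e = v"
      using balanced_ex_head_iff_ex_tail[OF fin bal] ends by blast
    then have "awalk v [e] (head G e)" using A(1) by (auto simp: awalk_Cons_iff awalk_Nil_iff)
    with w have "awalk u (p @ [e]) (head G e)" by (rule awalk_appendI)
    then have "?P (p @ [e])" using p e by auto
    from max[OF this] show False by simp
  qed
  ultimately show ?thesis
    using p w acyclic_awalk_imp_apath[OF acyclic] by (auto simp: route_def)
qed

text \<open>Stated for any balanced \<open>A\<close>, not just \<open>arcs G\<close>, so that
  induction applies to \<open>A\<close> minus a route.\<close>

lemma balanced_imp_disjoint_routes:
  assumes "A \<subseteq> arcs G" "balanced A"
  shows "\<exists>R. (\<forall>p \<in> R. route p) \<and> A = (\<Union>p \<in> R. set p) \<and>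
    pairwise (\<lambda>p q. disjnt (set p) (set q)) R"
proof -
  have "finite A" using assms(1) finite_arcs by (rule finite_subset)
  then show ?thesis using assms
  proof (induction A rule: finite_psubset_induct)
    case (psubset A)
    show ?case
    proof (cases "A = {}")
      case True
      then show ?thesis by (intro exI[of _ "{}"]) auto
    next
      case False
      then obtain p where p: "route p" "set p \<subseteq> A"
        using balanced_imp_ex_route psubset.prems by blast
      have "A - set p \<subset> A" using p hd_in_set[OF route_not_Nil[OF p(1)]] by blast
      moreover have "balanced (A - set p)"
        using p psubset.hyps psubset.prems balanced_route by (intro balanced_Diff) auto
      ultimately obtain R where R: "\<forall>p \<in> R. route p" "A - set p = (\<Union>p \<in> R. set p)"
        "pairwise (\<lambda>p q. disjnt (set p) (set q)) R"
        using psubset.IH[of "A - set p"] psubset.prems(1) by blast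
      have "A = (\<Union>q \<in> insert p R. set q)" using R(2) p(2) by auto
      \<comment> \<open>The routes in \<open>R\<close> use only arcs of \<open>A - set p\<close>, so
        they avoid \<open>p\<close>.\<close>
      moreover have "pairwise (\<lambda>p q. disjnt (set p) (set q)) (insert p R)"
        using R(2,3) by (fastforce simp: pairwise_insert disjnt_iff)
      ultimately show ?thesis using p(1) R(1) by (intro exI[of _ "insert p R"]) auto
    qed
  qed
qed

lemma route_decomposition_imp_balanced:
  assumes "route_decomposition R"
  shows "balanced (arcs G)"
proof -
  \<comment> \<open>Finiteness of \<open>R\<close> is not part of a decomposition; it follows
    because a finite digraph has finitely many paths.\<close>
  have "R \<subseteq> {p. apath s p t}"
    using assms by (auto simp: route_decomposition_def route_def)
  then have "finite R" using apaths_finite by (rule finite_subset)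
  then have "balanced (\<Union>p\<in>R. set p)"
    using assms by (intro balanced_UN) (auto simp: route_decomposition_def balanced_route)
  then show ?thesis using assms by (simp add: route_decomposition_def)
qed

theorem degree_equality_iff_route_decomposition:
  "degree_equality \<longleftrightarrow> (\<exists>R. route_decomposition R)"
  unfolding balanced_arcs_iff[symmetric]
  using balanced_imp_disjoint_routes[of "arcs G"] route_decomposition_imp_balanced
  by (auto simp: route_decomposition_def)

end

theorem theorem3p5:
  fixes G :: "('a, 'b) pre_digraph" and s t :: 'a
  assumes "st_dag G s t"
    and "\<forall>e \<in> arcs G. \<not> st_dag.idle G s t e"
  shows "st_dag.degree_equality G s t \<longleftrightarrow> (\<exists>R. st_dag.route_decomposition G s t R)"
  using assms(1) by (rule st_dag.degree_equality_iff_route_decomposition)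

end
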